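(* Let \(n\ge 2\) and \(m\ge 2\) be integers. Let \(A_{n,m}=\{w=(w_0,\ldots,w_{n-1})\in(\mathbb Z_m)^n:\sum_{i=0}^{n-1}w_i=0\}\), and put \(q_i=e_i-e_{n-1}\in A_{n,m}\) for \(0\le i\le n-2\) and \(q_{n-1}=0\). Suppose functions \(d_t:A_{n,m}\times\mathbb Z_n\to\mathbb Z_n\), \(t\in\mathbb Z_m\), satisfy: (1) for every \(t\in\mathbb Z_m\) and \(w\in A_{n,m}\), the map \(\kappa\mapsto d_t(w,\kappa)\) is a permutation of \(\mathbb Z_n\); (2) for every \(t\in\mathbb Z_m\) and \(\kappa\in\mathbb Z_n\), the map \(P_{t,\kappa}:A_{n,m}\to A_{n,m}\), \(P_{t,\kappa}(w)=w+q_{d_t(w,\kappa)}\), is a bijection; (3) for every \(\kappa\in\mathbb Z_n\), the composition \(R_\kappa=P_{m-1,\kappa}\circ\cdots\circ P_{1,\kappa}\circ P_{0,\kappa}\) is a single cycle on \(A_{n,m}\) (a cyclic permutation of length \(m^{n-1}\)). Then the directed torus \(D_n(m)=\operatorname{Cay}((\mathbb Z_m)^n,\{e_0,\ldots,e_{n-1}\})\) admits a directed Hamilton decomposition.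
   Context: \(e_0,\ldots,e_{n-1}\) are the standard basis vectors of \((\mathbb Z_m)^n\); the Cayley digraph has vertex set \((\mathbb Z_m)^n\) and arcs \(x\to x+e_i\) for all \(x\) and \(i\). A directed Hamilton decomposition is a partition of the arc set into directed Hamilton cycles. (A family \((d_t)_{t\in\mathbb Z_m}\) satisfying (1)–(3) is called a valid \((n,m)\)-root-flat certificate.) *)

theory Defs
  imports
    "HOL-Algebra.Product_Groups"
    "HOL-Combinatorics.Orbits"
    "HOL-Library.Disjoint_Sets"
    "Graph_Theory.Arc_Walk"
begin

text \<open>
  The additive group of vectors of length \<open>n\<close> over the integers modulo \<open>m\<close>. It is written
  multiplicatively by HOL-Algebra: \<open>\<otimes>\<close> is vector addition, \<open>\<one>\<close> the zero vector and \<open>inv\<close>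
  negation. Its elements are the functions in \<open>{..<n} \<rightarrow>\<^sub>E {0..<int m}\<close> (for \<open>m > 0\<close>).
\<close>
definition Zvec :: "nat \<Rightarrow> nat \<Rightarrow> (nat \<Rightarrow> int) monoid" where
  "Zvec n m = product_group {..<n} (\<lambda>_. integer_mod_group m)"

text \<open>The value \<open>1\<close> is a canonical representative modulo \<open>m\<close> only for \<open>m \<ge> 2\<close>.\<close>
definition unit_vec :: "nat \<Rightarrow> nat \<Rightarrow> (nat \<Rightarrow> int)" where
  "unit_vec n i = (\<lambda>j\<in>{..<n}. if j = i then 1 else 0)"

definition cayley_digraph :: "('a, 'b) monoid_scheme \<Rightarrow> 'a set \<Rightarrow> ('a, 'a \<times> 'a) pre_digraph" where
  "cayley_digraph G S =
    \<lparr> verts = carrier G,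
      arcs = {(x, x \<otimes>\<^bsub>G\<^esub> s) | x s. x \<in> carrier G \<and> s \<in> S},
      tail = fst,
      head = snd \<rparr>"

definition directed_torus :: "nat \<Rightarrow> nat \<Rightarrow> (nat \<Rightarrow> int, (nat \<Rightarrow> int) \<times> (nat \<Rightarrow> int)) pre_digraph" where
  "directed_torus n m = cayley_digraph (Zvec n m) (unit_vec n ` {..<n})"

definition hamilton_cycle :: "('a, 'b) pre_digraph \<Rightarrow> 'b awalk \<Rightarrow> bool" where
  "hamilton_cycle G p \<longleftrightarrow> pre_digraph.cycle G p \<and> tail G ` set p = verts G"

definition has_hamilton_decomposition :: "('a, 'b) pre_digraph \<Rightarrow> bool" where
  "has_hamilton_decomposition G \<longleftrightarrow>
    (\<exists>D. partition_on (arcs G) D \<and> (\<forall>H\<in>D. \<exists>p. hamilton_cycle G p \<and> set p = H))"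

definition root_flat :: "nat \<Rightarrow> nat \<Rightarrow> (nat \<Rightarrow> int) set" where
  "root_flat n m = {w \<in> carrier (Zvec n m). (\<Sum>i<n. w i) mod int m = 0}"

definition root_step :: "nat \<Rightarrow> nat \<Rightarrow> nat \<Rightarrow> (nat \<Rightarrow> int)" where
  "root_step n m i =
    (if i = n - 1 then \<one>\<^bsub>Zvec n m\<^esub>
     else unit_vec n i \<otimes>\<^bsub>Zvec n m\<^esub> inv\<^bsub>Zvec n m\<^esub> unit_vec n (n - 1))"

text \<open>
  In the following, \<open>d t w \<kappa>\<close> stands for $d_t(w,\kappa)$; residues modulo \<open>m\<close> (for \<open>t\<close>) and modulo
  \<open>n\<close> (for \<open>\<kappa>\<close>) serve only as labels and are represented by the naturals below \<open>m\<close> and \<open>n\<close>.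
\<close>
definition layer_map ::
    "nat \<Rightarrow> nat \<Rightarrow> (nat \<Rightarrow> (nat \<Rightarrow> int) \<Rightarrow> nat \<Rightarrow> nat) \<Rightarrow> nat \<Rightarrow> nat \<Rightarrow> (nat \<Rightarrow> int) \<Rightarrow> (nat \<Rightarrow> int)" where
  "layer_map n m d t \<kappa> w = w \<otimes>\<^bsub>Zvec n m\<^esub> root_step n m (d t w \<kappa>)"

text \<open>\<open>fold\<close> applies the layers in increasing order, the one for \<open>t = 0\<close> first.\<close>
definition return_map ::
    "nat \<Rightarrow> nat \<Rightarrow> (nat \<Rightarrow> (nat \<Rightarrow> int) \<Rightarrow> nat \<Rightarrow> nat) \<Rightarrow> nat \<Rightarrow> (nat \<Rightarrow> int) \<Rightarrow> (nat \<Rightarrow> int)" where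
  "return_map n m d \<kappa> = fold (\<lambda>t. layer_map n m d t \<kappa>) [0..<m]"

end

theory Submission
  imports Defs
begin

text \<open>
  The sum of the coordinates modulo \<open>m\<close> cuts the torus into \<open>m\<close> layers, and each layer is a
  translate of \<open>root_flat n m\<close> by a multiple of \<open>e\<^sub>n\<^sub>-\<^sub>1\<close>. Since \<open>e\<^sub>i = q\<^sub>i + e\<^sub>n\<^sub>-\<^sub>1\<close>, following at each
  vertex the arc selected by colour \<open>\<kappa>\<close> moves from one layer to the next and acts there as
  \<open>P\<^sub>t\<^sub>,\<^sub>\<kappa>\<close>. After \<open>m\<close> steps it returns to the initial layer and has performed \<open>R\<^sub>\<kappa>\<close>. As \<open>R\<^sub>\<kappa>\<close> is
  a single cycle and the \<open>P\<^sub>t\<^sub>,\<^sub>\<kappa>\<close> are onto, the arcs of colour \<open>\<kappa>\<close> form one Hamilton cycle; as the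
  colours permute the directions at every vertex, each arc has exactly one colour.
\<close>

section \<open>Hamilton cycles from cyclic maps\<close>

text \<open>The start \<open>i\<close> stays arbitrary because \<open>cas\<close> consumes arcs from
  the front: the induction hypothesis is needed at \<open>Suc i\<close>.\<close>

lemma cas_funpow:
  fixes G :: "('a, 'a \<times> 'a) pre_digraph"
  assumes "tail G = fst" and "head G = snd"
  shows "pre_digraph.cas G ((f ^^ i) s) (map (\<lambda>k. ((f ^^ k) s, (f ^^ Suc k) s)) [i..<i + l]) ((f ^^ (i + l)) s)"
proof (induction l arbitrary: i)
  case (Suc l)
  show ?case
    using Suc[of "Suc i"] by (simp add: assms upt_conv_Cons pre_digraph.cas.simps del: upt_Suc)
qed (simp add: pre_digraph.cas.simps)

lemma hamilton_cycle_of_cyclic_on: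
  assumes G: "tail G = fst" "head G = snd"
    and cyc: "cyclic_on f (verts G)"
    and arcs: "(\<lambda>x. (x, f x)) ` verts G \<subseteq> arcs G"
  obtains p where "hamilton_cycle G p" and "set p = (\<lambda>x. (x, f x)) ` verts G"
proof -
  interpret pre_digraph G .
  from cyc obtain s where s: "s \<in> verts G" and orb: "verts G = orbit f s"
    by (auto simp: cyclic_on_def)
  then have self: "s \<in> orbit f s" by simp
  \<comment> \<open>The time of the first return to \<open>s\<close>; before it, the iterates are
    distinct and exhaust the orbit.\<close>
  define N where "N = funpow_dist1 f s s"
  define p where "p = map (\<lambda>k. ((f ^^ k) s, (f ^^ Suc k) s)) [0..<N]"
  have N: "0 < N" "(f ^^ N) s = s"
    using funpow_dist1_prop[OF self] by (simp_all add: N_def)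
  have V: "verts G = (\<lambda>k. (f ^^ k) s) ` {0..<N}"
    using orbit_conv_funpow_dist1[OF self] orb by (simp add: N_def)
  have set_p: "set p = (\<lambda>x. (x, f x)) ` verts G"
    by (auto simp: p_def V image_image)
  have cas: "cas s p s"
    using cas_funpow[OF G, of 0 f s N] N by (simp add: p_def)
  have tails: "map (tail G) p = map (\<lambda>k. (f ^^ k) s) [0..<N]"
    by (simp add: p_def G)
  have "distinct (map (tail G) p)"
    using inj_on_funpow_dist1[OF self] by (simp add: tails distinct_map N_def del: upt_Suc)
  moreover have "map (tail G) p = s # tl (map (tail G) p)"
    using N(1) by (simp add: tails upt_conv_Cons)
  moreover have "p \<noteq> []"
    using N(1) by (simp add: p_def)
  moreover have "head G (last p) = s"
    using N by (cases N) (simp_all add: p_def G)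
  \<comment> \<open>The vertex list is the list of tails followed by \<open>s\<close>. Dropping its
    first entry, again \<open>s\<close>, leaves a rotation of the list of tails.\<close>
  ultimately have "distinct (tl (awalk_verts s p))"
    by (metis awalk_verts_conv append_Cons distinct.simps(2) distinct1_rotate list.sel(3) rotate1.simps(2))
  with cas set_p arcs s \<open>p \<noteq> []\<close> have "cycle p"
    by (auto simp: cycle_def awalk_def)
  moreover have "tail G ` set p = verts G"
    by (simp add: set_p image_image G)
  ultimately show thesis
    using that set_p by (auto simp: hamilton_cycle_def)
qed

text \<open>The blocks are the graphs of the maps \<open>f k\<close>. An arc in two of them would
  give two colours the same image at its tail, against \<open>inj\<close>.\<close>

lemma has_hamilton_decompositionI:
  assumes G: "tail G = fst" "head G = snd"
    and cyc: "\<And>k. k \<in> K \<Longrightarrow> cyclic_on (f k) (verts G)"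
    and arcs: "arcs G = (\<Union>k\<in>K. (\<lambda>x. (x, f k x)) ` verts G)"
    and inj: "\<And>x k l. x \<in> verts G \<Longrightarrow> k \<in> K \<Longrightarrow> l \<in> K \<Longrightarrow> f k x = f l x \<Longrightarrow> k = l"
  shows "has_hamilton_decomposition G"
proof -
  define H where "H k = (\<lambda>x. (x, f k x)) ` verts G" for k
  have "partition_on (arcs G) (H ` K)"
  proof (rule partition_onI)
    show "\<Union> (H ` K) = arcs G"
      by (simp add: arcs H_def)
    show "{} \<notin> H ` K"
      using cyc by (auto simp: H_def cyclic_on_alldef)
    show "disjnt p q" if "p \<in> H ` K" "q \<in> H ` K" "p \<noteq> q" for p q
    proof -
      from that(1,2) obtain k l where "k \<in> K" "l \<in> K" "p = H k" "q = H l"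
        by blast
      with that(3) inj show ?thesis
        by (auto simp: H_def disjnt_iff)
    qed
  qed
  moreover have "\<exists>p. hamilton_cycle G p \<and> set p = H k" if "k \<in> K" for k
  proof (rule hamilton_cycle_of_cyclic_on[OF G cyc[OF that]])
    show "(\<lambda>x. (x, f k x)) ` verts G \<subseteq> arcs G"
      using that by (auto simp: arcs)
  qed (auto simp: H_def)
  ultimately show ?thesis
    unfolding has_hamilton_decomposition_def by blast
qed

section \<open>Layered cyclic maps\<close>

text \<open>The orbit of a point of \<open>L 0\<close> under \<open>f ^^ m\<close> fills
  \<open>L 0\<close>, and from there \<open>f\<close> sweeps through the other layers. The return
  from the last layer is contained in \<open>cyc\<close>.\<close>

lemma cyclic_on_layers:
  assumes "0 < m"
    and step: "\<And>t. Suc t < m \<Longrightarrow> f ` L t = L (Suc t)"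
    and cyc: "cyclic_on (f ^^ m) (L 0)"
  shows "cyclic_on f (\<Union>t<m. L t)"
proof -
  have L: "(f ^^ t) ` L 0 = L t" if "t < m" for t
    using that
  proof (induction t)
    case (Suc t)
    then show ?case
      using step[of t] by (simp flip: image_image add: image_comp[symmetric])
  qed simp
  from cyc obtain s where s: "s \<in> L 0" and orb: "L 0 = orbit (f ^^ m) s"
    by (auto simp: cyclic_on_def)
  have sub: "L 0 \<subseteq> orbit f s"
    \<comment> \<open>Orbits consist of positive iterates, and a positive multiple of
      \<open>m\<close> is positive.\<close>
    using \<open>0 < m\<close> unfolding orb orbit_altdef
    by (auto simp: funpow_mult)
  have "orbit f s = (\<Union>t<m. L t)"
  proof (intro equalityI subsetI)
    fix x assume "x \<in> orbit f s"
    then obtain k where "x = (f ^^ k) s"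
      by (auto simp: orbit_altdef)
    \<comment> \<open>The quotient counts full rounds, which stay in \<open>L 0\<close>; the
      remainder then climbs to a layer.\<close>
    also have "\<dots> = (f ^^ (k mod m + m * (k div m))) s"
      by simp
    also have "\<dots> = (f ^^ (k mod m)) (((f ^^ m) ^^ (k div m)) s)"
      by (simp only: funpow_add funpow_mult o_apply)
    also have "\<dots> \<in> L (k mod m)"
      using L[of "k mod m"] \<open>0 < m\<close> cyclic_on_funpow_in[OF cyc s] by auto
    finally show "x \<in> (\<Union>t<m. L t)"
      using \<open>0 < m\<close> by auto
  next
    fix x assume "x \<in> (\<Union>t<m. L t)"
    then obtain t u where "u \<in> L 0" "x = (f ^^ t) u"
      using L by blast
    with sub show "x \<in> orbit f s"
      by (auto intro: funpow_in_orbit)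
  qed
  moreover have "s \<in> (\<Union>t<m. L t)"
    using s \<open>0 < m\<close> by blast
  ultimately show ?thesis
    by (metis cyclic_on_singleI)
qed

section \<open>The layers of the torus\<close>

lemma pow_product_group:
  assumes "\<And>i. i \<in> I \<Longrightarrow> group (G i)" and "x \<in> carrier (product_group I G)"
  shows "x [^]\<^bsub>product_group I G\<^esub> (k::nat) = (\<lambda>i\<in>I. x i [^]\<^bsub>G i\<^esub> k)"
  by (induction k) (auto simp: fun_eq_iff)

lemma comm_group_Zvec: "comm_group (Zvec n m)"
proof -
  have "group (Zvec n m)"
    by (simp add: Zvec_def)
  then show ?thesis
    by (rule group.group_comm_groupI) (auto simp: Zvec_def add.commute)
qed

text \<open>A natural number, so that it can serve as the label \<open>t\<close> of
  \<open>d\<close>.\<close>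

definition height :: "nat \<Rightarrow> nat \<Rightarrow> (nat \<Rightarrow> int) \<Rightarrow> nat" where
  "height n m x = nat ((\<Sum>i<n. x i) mod int m)"

locale torus =
  fixes n m :: nat
  assumes n: "n \<ge> 2" and m: "m \<ge> 2"
begin

sublocale Z: comm_group "Zvec n m"
  by (rule comm_group_Zvec)

abbreviation e :: "nat \<Rightarrow> nat \<Rightarrow> int" where
  "e \<equiv> unit_vec n"

definition shift :: "nat \<Rightarrow> nat \<Rightarrow> int" where
  "shift t = e (n - 1) [^]\<^bsub>Zvec n m\<^esub> t"

lemma carrier_Zvec: "carrier (Zvec n m) = {..<n} \<rightarrow>\<^sub>E {0..<int m}"
  using m by (simp add: Zvec_def carrier_integer_mod_group)

lemma unit_vec_closed [simp]: "e i \<in> carrier (Zvec n m)"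
  using m by (auto simp: carrier_Zvec unit_vec_def)

lemma shift_0: "shift 0 = \<one>\<^bsub>Zvec n m\<^esub>"
  by (simp add: shift_def)

lemma shift_Suc: "shift (Suc t) = shift t \<otimes>\<^bsub>Zvec n m\<^esub> e (n - 1)"
  by (simp add: shift_def)

lemma shift_closed [simp]: "shift t \<in> carrier (Zvec n m)"
  by (simp add: shift_def)

lemma inj_on_unit_vec: "inj_on e {..<n}"
  by (auto simp: inj_on_def unit_vec_def fun_eq_iff split: if_splits)

lemma root_step_closed [simp]: "root_step n m i \<in> carrier (Zvec n m)"
  by (simp add: root_step_def)

lemma unit_vec_eq_root_step: "e i = root_step n m i \<otimes>\<^bsub>Zvec n m\<^esub> e (n - 1)"
  by (simp add: root_step_def Z.m_assoc)

lemma height_less: "height n m x < m"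
  using m by (simp add: height_def nat_less_iff)

text \<open>Reducing each coordinate modulo \<open>m\<close> does not change the sum modulo
  \<open>m\<close>.\<close>

lemma height_mult:
  "height n m (x \<otimes>\<^bsub>Zvec n m\<^esub> y) = (height n m x + height n m y) mod m"
proof -
  have "(\<Sum>i<n. (x i + y i) mod int m) mod int m = ((\<Sum>i<n. x i) + (\<Sum>i<n. y i)) mod int m"
    by (simp add: mod_sum_eq sum.distrib)
  then have "int (height n m (x \<otimes>\<^bsub>Zvec n m\<^esub> y)) = int ((height n m x + height n m y) mod m)"
    using m by (simp add: height_def Zvec_def zmod_int mod_add_eq)
  then show ?thesis
    by simp
qed

lemma height_unit_vec: "i < n \<Longrightarrow> height n m (e i) = 1"
  using m by (simp add: height_def unit_vec_def)

lemma height_shift: "height n m (shift t) = t mod m"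
proof (induction t)
  case 0
  show ?case by (simp add: shift_0 height_def Zvec_def)
next
  case (Suc t)
  then show ?case
    using n by (simp add: shift_Suc height_mult height_unit_vec mod_Suc_eq)
qed

text \<open>Every coordinate becomes a multiple of \<open>m\<close>. This is what closes up the
  layers after \<open>m\<close> steps.\<close>

lemma shift_period: "shift m = \<one>\<^bsub>Zvec n m\<^esub>"
proof -
  have "e (n - 1) \<in> carrier (product_group {..<n} (\<lambda>_. integer_mod_group m))"
    using unit_vec_closed by (simp only: Zvec_def)
  then show ?thesis
    unfolding shift_def Zvec_def by (subst pow_product_group) simp_all
qed

lemma root_flat_eq: "root_flat n m = {w \<in> carrier (Zvec n m). height n m w = 0}"
proof -
  have "(\<Sum>i<n. w i) mod int m = 0 \<longleftrightarrow> height n m w = 0" for w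
    using m pos_mod_sign[of "int m" "\<Sum>i<n. w i"] by (auto simp: height_def intro: order_antisym)
  then show ?thesis
    by (simp add: root_flat_def)
qed

definition layer :: "nat \<Rightarrow> (nat \<Rightarrow> int) set" where
  "layer t = {x \<in> carrier (Zvec n m). height n m x = t}"

lemma layer_eq_shift:
  assumes "t < m"
  shows "layer t = (\<lambda>w. w \<otimes>\<^bsub>Zvec n m\<^esub> shift t) ` root_flat n m"
proof (intro equalityI subsetI)
  fix x assume x: "x \<in> layer t"
  define w where "w = x \<otimes>\<^bsub>Zvec n m\<^esub> inv\<^bsub>Zvec n m\<^esub> shift t"
  have x_eq: "x = w \<otimes>\<^bsub>Zvec n m\<^esub> shift t" and w: "w \<in> carrier (Zvec n m)"
    using x by (simp_all add: w_def layer_def Z.m_assoc)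
  have "t = (height n m w + t) mod m"
    using x assms by (simp add: layer_def x_eq height_mult height_shift)
  \<comment> \<open>The sum wraps around at most once, and a wrap would force
    \<open>height n m w = m\<close>.\<close>
  then have "height n m w = 0"
    using height_less[of w] assms by (auto simp: mod_if split: if_splits)
  with x_eq w show "x \<in> (\<lambda>w. w \<otimes>\<^bsub>Zvec n m\<^esub> shift t) ` root_flat n m"
    by (auto simp: root_flat_eq)
next
  fix x assume "x \<in> (\<lambda>w. w \<otimes>\<^bsub>Zvec n m\<^esub> shift t) ` root_flat n m"
  with assms show "x \<in> layer t"
    by (auto simp: layer_def root_flat_eq height_mult height_shift)
qed

section \<open>Colour maps on the whole torus\<close>

definition proj :: "(nat \<Rightarrow> int) \<Rightarrow> (nat \<Rightarrow> int)" where
  "proj x = x \<otimes>\<^bsub>Zvec n m\<^esub> inv\<^bsub>Zvec n m\<^esub> shift (height n m x)"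

text \<open>Extends the certificate to all vertices: \<open>height\<close> supplies the label and
  \<open>proj\<close> the point of \<open>root_flat n m\<close> below \<open>x\<close>.\<close>

definition colour_step ::
    "(nat \<Rightarrow> (nat \<Rightarrow> int) \<Rightarrow> nat \<Rightarrow> nat) \<Rightarrow> nat \<Rightarrow> (nat \<Rightarrow> int) \<Rightarrow> (nat \<Rightarrow> int)" where
  "colour_step d \<kappa> x = x \<otimes>\<^bsub>Zvec n m\<^esub> e (d (height n m x) (proj x) \<kappa>)"

lemma proj_shift:
  assumes "t < m" and "w \<in> root_flat n m"
  shows "proj (w \<otimes>\<^bsub>Zvec n m\<^esub> shift t) = w"
  using assms by (simp add: proj_def root_flat_eq height_mult height_shift Z.m_assoc)

lemma proj_in_root_flat:
  assumes "x \<in> carrier (Zvec n m)"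
  shows "proj x \<in> root_flat n m"
proof -
  have "x \<in> layer (height n m x)"
    using assms by (simp add: layer_def)
  then obtain w where "w \<in> root_flat n m" "x = w \<otimes>\<^bsub>Zvec n m\<^esub> shift (height n m x)"
    unfolding layer_eq_shift[OF height_less] by blast
  then show ?thesis
    using proj_shift[OF height_less] by metis
qed

text \<open>The root step acts on \<open>w\<close>, while the remaining \<open>e (n - 1)\<close>
  raises the shift. The case \<open>t = m - 1\<close> is included and is the wrap-around.\<close>

lemma colour_step_shift:
  assumes "t < m" and "w \<in> root_flat n m"
  shows "colour_step d \<kappa> (w \<otimes>\<^bsub>Zvec n m\<^esub> shift t) = layer_map n m d t \<kappa> w \<otimes>\<^bsub>Zvec n m\<^esub> shift (Suc t)"
proof -
  have w: "w \<in> carrier (Zvec n m)" and "height n m (w \<otimes>\<^bsub>Zvec n m\<^esub> shift t) = t"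
    using assms by (simp_all add: root_flat_eq height_mult height_shift)
  then have "colour_step d \<kappa> (w \<otimes>\<^bsub>Zvec n m\<^esub> shift t) =
      w \<otimes>\<^bsub>Zvec n m\<^esub> shift t \<otimes>\<^bsub>Zvec n m\<^esub> (root_step n m (d t w \<kappa>) \<otimes>\<^bsub>Zvec n m\<^esub> e (n - 1))"
    using assms unfolding unit_vec_eq_root_step[symmetric] by (simp add: colour_step_def proj_shift)
  also have "\<dots> = layer_map n m d t \<kappa> w \<otimes>\<^bsub>Zvec n m\<^esub> shift (Suc t)"
    using w by (simp add: layer_map_def shift_Suc Z.m_ac)
  finally show ?thesis .
qed

lemma colour_step_layer:
  assumes "Suc t < m" and "layer_map n m d t \<kappa> ` root_flat n m = root_flat n m"
  shows "colour_step d \<kappa> ` layer t = layer (Suc t)"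
proof -
  have "colour_step d \<kappa> ` layer t =
      (\<lambda>w. layer_map n m d t \<kappa> w \<otimes>\<^bsub>Zvec n m\<^esub> shift (Suc t)) ` root_flat n m"
    unfolding layer_eq_shift[OF Suc_lessD[OF assms(1)]] image_image
    using assms(1) by (intro image_cong colour_step_shift) auto
  also have "\<dots> = (\<lambda>w. w \<otimes>\<^bsub>Zvec n m\<^esub> shift (Suc t)) ` (layer_map n m d t \<kappa> ` root_flat n m)"
    by (simp only: image_image)
  finally show ?thesis
    by (simp only: assms(2) layer_eq_shift[OF assms(1)])
qed

text \<open>Membership is proved along with the formula, since \<open>colour_step_shift\<close>
  requires it at the next step.\<close>

lemma funpow_colour_step:
  assumes maps: "\<And>t. t < m \<Longrightarrow> layer_map n m d t \<kappa> ` root_flat n m \<subseteq> root_flat n m"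
    and w: "w \<in> root_flat n m" and "t \<le> m"
  shows "fold (\<lambda>t. layer_map n m d t \<kappa>) [0..<t] w \<in> root_flat n m \<and>
    (colour_step d \<kappa> ^^ t) w = fold (\<lambda>t. layer_map n m d t \<kappa>) [0..<t] w \<otimes>\<^bsub>Zvec n m\<^esub> shift t"
  using \<open>t \<le> m\<close>
proof (induction t)
  case 0
  then show ?case
    using w by (simp add: root_flat_eq shift_0)
next
  case (Suc t)
  then show ?case
    using maps[of t] by (auto simp: colour_step_shift)
qed

lemma cyclic_on_colour_step:
  assumes maps: "\<And>t. t < m \<Longrightarrow> layer_map n m d t \<kappa> ` root_flat n m = root_flat n m"
    and cyc: "cyclic_on (return_map n m d \<kappa>) (root_flat n m)"
  shows "cyclic_on (colour_step d \<kappa>) (carrier (Zvec n m))"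
proof -
  \<comment> \<open>At \<open>t = m\<close> the shift is the zero vector and disappears.\<close>
  have "(colour_step d \<kappa> ^^ m) w = return_map n m d \<kappa> w" if "w \<in> root_flat n m" for w
    using funpow_colour_step[OF equalityD1[OF maps] that order_refl]
    by (auto simp: return_map_def shift_period root_flat_eq)
  then have "cyclic_on (colour_step d \<kappa> ^^ m) (root_flat n m)"
    using cyc by (metis (no_types, lifting) cyclic_cong)
  then have "cyclic_on (colour_step d \<kappa> ^^ m) (layer 0)"
    by (simp add: layer_def root_flat_eq)
  then have "cyclic_on (colour_step d \<kappa>) (\<Union>t<m. layer t)"
    using m by (intro cyclic_on_layers colour_step_layer maps) auto
  moreover have "(\<Union>t<m. layer t) = carrier (Zvec n m)"
    using height_less by (auto simp: layer_def)
  ultimately show ?thesis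
    by simp
qed

text \<open>Cancelling \<open>x\<close> leaves equal unit vectors, hence equal directions, and
  \<open>d\<close> is injective in the colour.\<close>

lemma colour_step_inj:
  assumes d: "\<And>t w. t < m \<Longrightarrow> w \<in> root_flat n m \<Longrightarrow> bij_betw (d t w) {..<n} {..<n}"
    and x: "x \<in> carrier (Zvec n m)" and "\<kappa> < n" "\<mu> < n"
    and eq: "colour_step d \<kappa> x = colour_step d \<mu> x"
  shows "\<kappa> = \<mu>"
proof -
  have bij: "bij_betw (d (height n m x) (proj x)) {..<n} {..<n}"
    using d height_less proj_in_root_flat[OF x] by blast
  then have "inj_on (e \<circ> d (height n m x) (proj x)) {..<n}"
    using inj_on_unit_vec by (simp add: bij_betw_def comp_inj_on)
  moreover have "e (d (height n m x) (proj x) \<kappa>) = e (d (height n m x) (proj x) \<mu>)"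
    using eq x by (simp add: colour_step_def)
  ultimately show ?thesis
    using \<open>\<kappa> < n\<close> \<open>\<mu> < n\<close> by (simp add: inj_on_def)
qed

text \<open>Here the surjectivity of \<open>d\<close> in the colour enters: every direction at
  \<open>x\<close> is the one chosen by some colour.\<close>

lemma arcs_directed_torus:
  assumes d: "\<And>t w. t < m \<Longrightarrow> w \<in> root_flat n m \<Longrightarrow> bij_betw (d t w) {..<n} {..<n}"
  shows "arcs (directed_torus n m) =
    (\<Union>\<kappa>\<in>{..<n}. (\<lambda>x. (x, colour_step d \<kappa> x)) ` carrier (Zvec n m))"
proof -
  have "d (height n m x) (proj x) ` {..<n} = {..<n}" if "x \<in> carrier (Zvec n m)" for x
    using d[OF height_less proj_in_root_flat[OF that]] by (simp add: bij_betw_imp_surj_on)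
  then have "e ` {..<n} = (\<lambda>\<kappa>. e (d (height n m x) (proj x) \<kappa>)) ` {..<n}"
    if "x \<in> carrier (Zvec n m)" for x
    using that by (simp flip: image_image)
  then show ?thesis
    by (fastforce simp: directed_torus_def cayley_digraph_def colour_step_def)
qed

end

theorem theorem2p2:
  fixes n m :: nat
    and d :: "nat \<Rightarrow> (nat \<Rightarrow> int) \<Rightarrow> nat \<Rightarrow> nat"
  assumes "n \<ge> 2" and "m \<ge> 2"
    and "\<And>t w. t < m \<Longrightarrow> w \<in> root_flat n m \<Longrightarrow> bij_betw (d t w) {..<n} {..<n}"
    and "\<And>t \<kappa>. t < m \<Longrightarrow> \<kappa> < n \<Longrightarrow> bij_betw (layer_map n m d t \<kappa>) (root_flat n m) (root_flat n m)"
    and "\<And>\<kappa>. \<kappa> < n \<Longrightarrow> cyclic_on (return_map n m d \<kappa>) (root_flat n m)"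
  shows "has_hamilton_decomposition (directed_torus n m)"
proof -
  interpret torus n m
    using assms(1,2) by unfold_locales
  have verts: "verts (directed_torus n m) = carrier (Zvec n m)"
    by (simp add: directed_torus_def cayley_digraph_def)
  show ?thesis
  proof (rule has_hamilton_decompositionI[where K = "{..<n}" and f = "colour_step d"])
    show "tail (directed_torus n m) = fst" "head (directed_torus n m) = snd"
      by (simp_all add: directed_torus_def cayley_digraph_def)
    show "cyclic_on (colour_step d \<kappa>) (verts (directed_torus n m))" if "\<kappa> \<in> {..<n}" for \<kappa>
      \<comment> \<open>The bijectivity of the layer maps enters as surjectivity, which makes each
        layer map onto the next.\<close>
      unfolding verts using that assms(4,5)
      by (intro cyclic_on_colour_step bij_betw_imp_surj_on) auto
    show "arcs (directed_torus n m) =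
        (\<Union>\<kappa>\<in>{..<n}. (\<lambda>x. (x, colour_step d \<kappa> x)) ` verts (directed_torus n m))"
      unfolding verts by (rule arcs_directed_torus[OF assms(3)])
    show "\<kappa> = \<mu>" if "x \<in> verts (directed_torus n m)" "\<kappa> \<in> {..<n}" "\<mu> \<in> {..<n}"
      "colour_step d \<kappa> x = colour_step d \<mu> x" for x \<kappa> \<mu>
      using colour_step_inj[OF assms(3)] that by (auto simp: verts)
  qed
qed

end
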